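(* Let $\mathbb{A}$ and $\mathbb{B}$ be two tensors of order $m\ge 3$ and dimension $n$. If $\mathbb{A}$ and $\mathbb{B}$ are similar, then there exists a tensor $\mathbb{C}$ of order $m$ and dimension $n$ such that $\mathbb{A}$ and $\mathbb{C}$ are diagonal similar, and $\mathbb{B}$ and $\mathbb{C}$ are permutational similar.
   Context: Write $[n]=\{1,\ldots,n\}$. An order $m$ dimension $n$ tensor $\mathbb{A}=(a_{i_1i_2\ldots i_m})$ is a multidimensional array of complex numbers $a_{i_1\ldots i_m}$ indexed by $i_1,\ldots,i_m\in[n]$. The unit tensor of order $m$ and dimension $n$ is $\mathbb{I}=(\delta_{i_1\ldots i_m})$ with $\delta_{i_1\ldots i_m}=1$ if $i_1=\cdots=i_m$ and $0$ otherwise. For complex matrices $P=(p_{ij}),Q=(q_{ij})$ of order $n$ and a tensor $\mathbb{A}$ of order $m$ and dimension $n$, the product $P\mathbb{A}Q$ is the order $m$ dimension $n$ tensor with entries $$(P\mathbb{A}Q)_{i_1\ldots i_m}=\sum_{j_1,\ldots,j_m=1}^n p_{i_1j_1}a_{j_1j_2\ldots j_m}q_{j_2i_2}\cdots q_{j_mi_m}.$$ Let $\mathbb{A},\mathbb{B}$ be order $m$ dimension $n$ tensors. They are similar if there exist matrices $P,Q$ of order $n$ with $P\mathbb{I}Q=\mathbb{I}$ and $\mathbb{B}=P\mathbb{A}Q$. They are permutational similar if $\mathbb{B}=P\mathbb{A}P^T$ for some permutation matrix $P$ of order $n$. They are diagonal similar if $\mathbb{B}=D^{-(m-1)}\mathbb{A}D$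 for some invertible diagonal matrix $D$ of order $n$. (All three are symmetric relations.) *)

theory Defs
  imports "HOL-Analysis.Analysis"
begin

text \<open>
  The index set \<open>[n]\<close> is a finite type \<open>'n\<close>, so the dimension is \<open>CARD('n)\<close>. An index tuple
  \<open>(i\<^sub>1, \<dots>, i\<^sub>m)\<close> is the list of length \<open>m\<close> with these entries; position \<open>k\<close> of the tuple is
  entry \<open>k - 1\<close> of the list. A tensor of order \<open>m\<close> is zero on lists of any other length, so that
  equality of tensors of order \<open>m\<close> is equality of functions.
\<close>

type_synonym 'n tensor = "'n list \<Rightarrow> complex"

definition tensors :: "nat \<Rightarrow> 'n::finite tensor set" where
  "tensors m = {A. \<forall>is. length is \<noteq> m \<longrightarrow> A is = 0}"

definition unit_tensor :: "nat \<Rightarrow> 'n::finite tensor" where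
  "unit_tensor m = (\<lambda>is. if length is = m \<and> (\<forall>k<m. \<forall>l<m. is ! k = is ! l) then 1 else 0)"

definition tensor_prod ::
  "nat \<Rightarrow> complex^'n^'n \<Rightarrow> 'n::finite tensor \<Rightarrow> complex^'n^'n \<Rightarrow> 'n tensor" where
  "tensor_prod m P A Q = (\<lambda>is. if length is = m
     then \<Sum>js | length js = m.
            P $ (is ! 0) $ (js ! 0) * A js * (\<Prod>k=1..<m. Q $ (js ! k) $ (is ! k))
     else 0)"

definition similar :: "nat \<Rightarrow> 'n::finite tensor \<Rightarrow> 'n tensor \<Rightarrow> bool" where
  "similar m A B \<longleftrightarrow>
     (\<exists>P Q. tensor_prod m P (unit_tensor m) Q = unit_tensor m \<and> B = tensor_prod m P A Q)"

definition permutation_matrix :: "complex^'n^'n::finite \<Rightarrow> bool" where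
  "permutation_matrix P \<longleftrightarrow>
     (\<exists>\<sigma>. \<sigma> permutes UNIV \<and> P = (\<chi> i j. if j = \<sigma> i then 1 else 0))"

definition permutational_similar :: "nat \<Rightarrow> 'n::finite tensor \<Rightarrow> 'n tensor \<Rightarrow> bool" where
  "permutational_similar m A B \<longleftrightarrow>
     (\<exists>P. permutation_matrix P \<and> B = tensor_prod m P A (transpose P))"

definition diagonal_matrix :: "complex^'n^'n::finite \<Rightarrow> bool" where
  "diagonal_matrix D \<longleftrightarrow> (\<forall>i j. i \<noteq> j \<longrightarrow> D $ i $ j = 0)"

primrec matrix_power :: "complex^'n^'n::finite \<Rightarrow> nat \<Rightarrow> complex^'n^'n" where
  "matrix_power M 0 = mat 1"
| "matrix_power M (Suc k) = M ** matrix_power M k"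

definition diagonal_similar :: "nat \<Rightarrow> 'n::finite tensor \<Rightarrow> 'n tensor \<Rightarrow> bool" where
  "diagonal_similar m A B \<longleftrightarrow>
     (\<exists>D. diagonal_matrix D \<and> invertible D \<and>
          B = tensor_prod m (matrix_power (matrix_inv D) (m - 1)) A D)"

end

theory Submission
  imports Defs
begin

text \<open>
  The equation \<open>P\<I>Q = \<I>\<close> forces both matrices to be monomial. Its entries at \<open>(i, a, \<dots>, a)\<close>
  say that \<open>P\<close> is inverse to the matrix \<open>R\<close> of entrywise powers \<open>q\<^sub>j\<^sub>a\<^sup>m\<^sup>-\<^sup>1\<close>. Its entries at
  \<open>(i, a, b, \<dots>, b)\<close> with \<open>a \<noteq> b\<close> vanish for every \<open>i\<close>, and cancelling the invertible matrix \<open>P\<close>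
  leaves \<open>q\<^sub>j\<^sub>a q\<^sub>j\<^sub>b\<^sup>m\<^sup>-\<^sup>2 = 0\<close>. As \<open>m \<ge> 3\<close>, a row of \<open>Q\<close> cannot have two nonzero entries; as \<open>R\<close> is
  invertible, no row and no column of \<open>Q\<close> is zero. So there are a permutation \<open>\<tau>\<close> and nonzero
  \<open>d\<^sub>j\<close> such that the only nonzero entry in row \<open>j\<close> of \<open>Q\<close> is \<open>d\<^sub>j\<close>, in column \<open>\<tau> j\<close>, and then
  \<open>P = R\<^sup>-\<^sup>1\<close> has the only nonzero entry \<open>d\<^sub>j\<^sup>-\<^sup>(\<^sup>m\<^sup>-\<^sup>1\<^sup>)\<close> in column \<open>j\<close>, in row \<open>\<tau> j\<close>
  (\<open>unit_preserving_pair_monomial\<close>).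

  A product with monomial matrices collapses to a single term (\<open>tensor_prod_monomial\<close>): it scales
  the entries of the tensor and relabels its indices. For \<open>P\<close> and \<open>Q\<close> the scaling is the one of the
  diagonal matrix \<open>D\<close> with entries \<open>d\<^sub>j\<close>, so \<open>C = D\<^sup>-\<^sup>(\<^sup>m\<^sup>-\<^sup>1\<^sup>) A D\<close> differs from \<open>B = PAQ\<close> only by the
  relabelling \<open>\<tau>\<close>.
\<close>

text \<open>
  In the sum over \<open>js\<close>, each factor \<open>p\<close> or \<open>q\<close> pins one entry of \<open>js\<close>, so \<open>js = map f is\<close> is the
  only term that survives. Diagonal matrices are the case \<open>f i = i\<close>; a permutation matrix and its
  transpose are the case where \<open>p\<close> and \<open>q\<close> are constantly \<open>1\<close>.
\<close>

lemma tensor_prod_monomial: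
  fixes A :: "'n::finite tensor"
  assumes "length is = m" "m > 0"
    and P: "\<And>i j. P $ i $ j = (if j = f i then p i else 0)"
    and Q: "\<And>i j. Q $ j $ i = (if j = f i then q i else 0)"
  shows "tensor_prod m P A Q is = p (is ! 0) * A (map f is) * (\<Prod>k=1..<m. q (is ! k))"
proof -
  let ?t = "\<lambda>js. P $ (is ! 0) $ (js ! 0) * A js * (\<Prod>k=1..<m. Q $ (js ! k) $ (is ! k))"
  have fin: "finite {js::'n list. length js = m}"
    using finite_lists_length_eq[of "UNIV :: 'n set" m] by simp
  have zero: "?t js = 0" if js: "length js = m" "js \<noteq> map f is" for js
  proof -
    obtain k where k: "k < m" "js ! k \<noteq> f (is ! k)"
      using js assms(1) by (metis length_map nth_equalityI nth_map)
    show ?thesis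
    proof (cases "k = 0")
      case True
      then show ?thesis using k P by simp
    next
      case False
      then have "\<exists>k\<in>{1..<m}. Q $ (js ! k) $ (is ! k) = 0"
        using k Q by (intro bexI[of _ k]) auto
      then show ?thesis by simp
    qed
  qed
  have "tensor_prod m P A Q is = (\<Sum>js | length js = m. ?t js)"
    by (simp add: tensor_prod_def assms(1))
  also have "\<dots> = (\<Sum>js\<in>{map f is}. ?t js)"
    using zero fin assms(1) by (intro sum.mono_neutral_right) auto
  also have "\<dots> = p (is ! 0) * A (map f is) * (\<Prod>k=1..<m. q (is ! k))"
    using assms(1,2) by (simp add: P Q)
  finally show ?thesis .
qed

text \<open>
  Only constant tuples \<open>js\<close> contribute, so the sum over tuples becomes a sum over one index. Splitting
  off the first index \<open>i\<close> lets the right-hand side be read as \<open>P\<close> applied to a vector that depends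
  on \<open>t\<close> alone.
\<close>

lemma tensor_prod_unit_tensor:
  fixes P Q :: "complex^'n^'n::finite"
  assumes "length t = n"
  shows "tensor_prod (Suc n) P (unit_tensor (Suc n)) Q (i # t)
       = (\<Sum>j\<in>UNIV. P $ i $ j * prod_list (map (\<lambda>a. Q $ j $ a) t))"
proof -
  let ?m = "Suc n"
  let ?g = "\<lambda>js. P $ i $ (js ! 0) * unit_tensor ?m js *
              (\<Prod>k=1..<?m. Q $ (js ! k) $ ((i # t) ! k))"
  have fin: "finite {js::'n list. length js = ?m}"
    using finite_lists_length_eq[of "UNIV :: 'n set" ?m] by simp
  have const: "js \<in> range (replicate ?m)" if "unit_tensor ?m js \<noteq> 0" for js :: "'n list"
  proof -
    have len: "length js = ?m" and const: "\<forall>k<?m. \<forall>l<?m. js ! k = js ! l"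
      using that unfolding unit_tensor_def by metis+
    have "js = replicate ?m (js ! 0)"
    proof (rule nth_equalityI)
      fix k assume "k < length js"
      then have "k < ?m" using len by simp
      with const[rule_format, of k 0] show "js ! k = replicate ?m (js ! 0) ! k"
        by (simp del: replicate_Suc)
    qed (simp add: len)
    then show ?thesis by (rule range_eqI)
  qed
  have unit: "unit_tensor ?m (replicate ?m j) = 1" for j :: 'n
    by (auto simp: unit_tensor_def simp del: replicate_Suc)
  have "tensor_prod ?m P (unit_tensor ?m) Q (i # t) = (\<Sum>js | length js = ?m. ?g js)"
    by (simp add: tensor_prod_def assms)
  also have "\<dots> = (\<Sum>js\<in>range (replicate ?m). ?g js)"
  proof (rule sum.mono_neutral_right[OF fin])
    show "\<forall>js\<in>{js. length js = ?m} - range (replicate ?m). ?g js = 0"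
      using const by (metis DiffD2 mult_zero_left mult_zero_right)
  qed auto
  also have "\<dots> = (\<Sum>j\<in>UNIV. ?g (replicate ?m j))"
    by (subst sum.reindex) (simp_all only: inj_on_def replicate_Suc list.inject comp_def, simp)
  also have "\<dots> = (\<Sum>j\<in>UNIV. P $ i $ j * prod_list (map (\<lambda>a. Q $ j $ a) t))"
  proof (rule sum.cong[OF refl])
    fix j
    have "(\<Prod>k=1..<?m. Q $ (replicate ?m j ! k) $ ((i # t) ! k))
        = (\<Prod>k=1..<?m. Q $ j $ ((i # t) ! k))"
      by (intro prod.cong) (auto simp del: replicate_Suc)
    also have "\<dots> = (\<Prod>k=0..<n. Q $ j $ (t ! k))"
      using prod.shift_bounds_Suc_ivl[of "\<lambda>k. Q $ j $ ((i # t) ! k)" 0 n] by simp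
    also have "\<dots> = prod_list (map (\<lambda>a. Q $ j $ a) t)"
      using assms by (simp add: prod.list_conv_set_nth)
    finally show "?g (replicate ?m j) = P $ i $ j * prod_list (map (\<lambda>a. Q $ j $ a) t)"
      using unit[of j] by simp
  qed
  finally show ?thesis .
qed

text \<open>
  Distinct columns of \<open>Q\<close> have disjoint supports because the off-diagonal entries of the unit tensor
  vanish, and invertibility of the matrix of powers of the entries of \<open>Q\<close> makes \<open>\<tau>\<close> onto, hence
  bijective. Order \<open>m = 2\<close> is different: there the equation says only that \<open>P\<close> and \<open>Q\<close> are
  inverse to each other. The tuple \<open>(i, a, b, \<dots>, b)\<close>
  with \<open>a \<noteq> b\<close> exists only from order \<open>3\<close> on.
\<close>

lemma unit_preserving_pair_monomial:
  fixes P Q :: "complex^'n^'n::finite"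
  assumes "m \<ge> 3"
    and PQ: "tensor_prod m P (unit_tensor m) Q = unit_tensor m"
  obtains \<tau> d where "bij \<tau>" "\<And>j. d j \<noteq> 0"
    "\<And>i j. Q $ j $ i = (if i = \<tau> j then d j else 0)"
    "\<And>i j. P $ i $ j = (if i = \<tau> j then inverse (d j) ^ (m - 1) else 0)"
proof -
  \<comment> \<open>With \<open>m = n + 3\<close>, the tuples \<open>i # a # replicate (Suc n) b\<close> have length \<open>m\<close> and contain \<open>b\<close>.\<close>
  define n where "n = m - 3"
  have m: "m = Suc (Suc (Suc n))" using assms(1) by (simp add: n_def)
  define R :: "complex^'n^'n" where "R = (\<chi> j a. (Q $ j $ a) ^ (m - 1))"
  have entry: "(\<Sum>j\<in>UNIV. P $ i $ j * prod_list (map (\<lambda>a. Q $ j $ a) t)) = unit_tensor m (i # t)"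
    if "length t = Suc (Suc n)" for i t
    using tensor_prod_unit_tensor[OF that, of P Q i] PQ by (simp add: m)
  have "(P ** R) $ i $ a = mat 1 $ i $ a" for i a
  proof -
    have "(P ** R) $ i $ a
        = (\<Sum>j\<in>UNIV. P $ i $ j * prod_list (map (\<lambda>a. Q $ j $ a) (replicate (Suc (Suc n)) a)))"
      by (simp add: matrix_matrix_mult_def R_def m prod_list_replicate)
    also have "\<dots> = unit_tensor m (i # replicate (Suc (Suc n)) a)"
      by (rule entry) simp
    also have "\<dots> = mat 1 $ i $ a"
    proof (cases "i = a")
      case True
      have "unit_tensor m (replicate m a) = 1"
        by (simp add: unit_tensor_def)
      then show ?thesis using True by (simp add: m mat_def)
    next
      case False
      then have "\<not> (\<forall>k<m. \<forall>l<m. (i # replicate (Suc (Suc n)) a) ! k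
                               = (i # replicate (Suc (Suc n)) a) ! l)"
        by (force simp: m)
      then show ?thesis using False by (simp add: unit_tensor_def mat_def)
    qed
    finally show ?thesis .
  qed
  then have PR: "P ** R = mat 1" by (simp add: vec_eq_iff)
  then have RP: "R ** P = mat 1" by (simp add: matrix_left_right_inverse)
  have orth: "Q $ j $ a = 0 \<or> Q $ j $ b = 0" if "a \<noteq> b" for j a b
  proof -
    define x :: "complex^'n" where "x = (\<chi> j. Q $ j $ a * (Q $ j $ b) ^ Suc n)"
    have "(P *v x) $ i = 0" for i
    proof -
      have "(P *v x) $ i
          = (\<Sum>j\<in>UNIV. P $ i $ j * prod_list (map (\<lambda>a. Q $ j $ a) (a # replicate (Suc n) b)))"
        by (simp add: matrix_vector_mult_def x_def prod_list_replicate)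
      also have "\<dots> = unit_tensor m (i # a # replicate (Suc n) b)"
        by (rule entry) simp
      also have "\<dots> = 0"
      proof -
        have "\<not> (\<forall>k<m. \<forall>l<m. (i # a # replicate (Suc n) b) ! k
                             = (i # a # replicate (Suc n) b) ! l)"
        proof
          assume "\<forall>k<m. \<forall>l<m. (i # a # replicate (Suc n) b) ! k
                               = (i # a # replicate (Suc n) b) ! l"
          \<comment> \<open>The entries at these two positions are \<open>a\<close> and \<open>b\<close>.\<close>
          from this[rule_format, of 1 2] that show False by (simp add: m)
        qed
        then show ?thesis by (simp add: unit_tensor_def)
      qed
      finally show ?thesis .
    qed
    then have "P *v x = 0" by (simp add: vec_eq_iff)
    then have "R *v (P *v x) = 0" by simp
    then have "x = 0" by (simp add: matrix_vector_mul_assoc RP)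
    then have "Q $ j $ a * (Q $ j $ b) ^ Suc n = 0"
      by (metis x_def vec_lambda_beta zero_index)
    then show ?thesis by auto
  qed
  \<comment> \<open>A zero row or column of \<open>Q\<close> is one of \<open>R\<close> too, against invertibility.\<close>
  have row: "\<exists>a. Q $ j $ a \<noteq> 0" for j
  proof (rule ccontr)
    assume "\<nexists>a. Q $ j $ a \<noteq> 0"
    then have "(R ** P) $ j $ j = 0" by (simp add: matrix_matrix_mult_def R_def m)
    then show False by (simp add: RP mat_def)
  qed
  have col: "\<exists>j. Q $ j $ a \<noteq> 0" for a
  proof (rule ccontr)
    assume "\<nexists>j. Q $ j $ a \<noteq> 0"
    then have "(P ** R) $ a $ a = 0" by (simp add: matrix_matrix_mult_def R_def m)
    then show False by (simp add: PR mat_def)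
  qed
  obtain \<tau> where \<tau>: "\<And>j. Q $ j $ \<tau> j \<noteq> 0" using row by metis
  define d where "d = (\<lambda>j. Q $ j $ \<tau> j)"
  have d: "d j \<noteq> 0" for j using \<tau> by (simp add: d_def)
  have Q: "Q $ j $ i = (if i = \<tau> j then d j else 0)" for i j
    using orth[of i "\<tau> j" j] \<tau>[of j] by (auto simp: d_def)
  have "surj \<tau>" unfolding surj_def using col Q by metis
  then have bij: "bij \<tau>" by (simp add: finite_UNIV_surj_inj bij_def)
  have P: "P $ i $ j = (if i = \<tau> j then inverse (d j) ^ (m - 1) else 0)" for i j
  proof -
    \<comment> \<open>Column \<open>\<tau> j\<close> of \<open>R\<close> has a single nonzero entry, so \<open>PR = 1\<close> determines column \<open>j\<close> of \<open>P\<close>.\<close>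
    have R: "R $ k $ \<tau> j = (if k = j then d j ^ (m - 1) else 0)" for k
      using bij by (auto simp: R_def Q m bij_def inj_eq)
    have "(P ** R) $ i $ \<tau> j = P $ i $ j * d j ^ (m - 1)"
      by (simp add: matrix_matrix_mult_def R if_distrib[of "\<lambda>x. _ * x"] cong: if_cong)
    then have "P $ i $ j * d j ^ (m - 1) = (if i = \<tau> j then 1 else 0)"
      by (simp add: PR mat_def)
    then show ?thesis using d[of j] by (auto simp: field_simps)
  qed
  show thesis using that[of \<tau> d] bij d Q P by blast
qed

abbreviation diag :: "('n::finite \<Rightarrow> complex) \<Rightarrow> complex^'n^'n" where
  "diag e \<equiv> \<chi> i j. if j = i then e i else 0"

lemma diag_one: "diag (\<lambda>_. 1) = mat 1"
  by (auto simp: vec_eq_iff mat_def)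

lemma diag_mult: "diag e ** diag f = diag (\<lambda>i. e i * f i)"
proof -
  have "(diag e ** diag f) $ i $ j = diag (\<lambda>i. e i * f i) $ i $ j" for i j
  proof -
    have "(diag e ** diag f) $ i $ j
        = (\<Sum>l\<in>UNIV. if l = i then e i * (if j = i then f i else 0) else 0)"
      unfolding matrix_matrix_mult_def vec_lambda_beta by (rule sum.cong) auto
    then show ?thesis by simp
  qed
  then show ?thesis by (simp add: vec_eq_iff)
qed

lemma matrix_power_diag: "matrix_power (diag e) k = diag (\<lambda>i. e i ^ k)"
proof (induction k)
  case 0
  show ?case by (simp add: diag_one cong: if_cong)
next
  case (Suc k)
  then show ?case by (simp only: matrix_power.simps diag_mult power_Suc)
qed

lemma diag_inverse:
  assumes "\<And>i. e i \<noteq> 0"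
  shows "invertible (diag e)" "matrix_inv (diag e) = diag (\<lambda>i. inverse (e i))"
proof -
  let ?E = "diag (\<lambda>i. inverse (e i))"
  have DE: "diag e ** ?E = mat 1" and ED: "?E ** diag e = mat 1"
    using assms by (simp_all add: diag_mult diag_one cong: if_cong)
  show inv: "invertible (diag e)" unfolding invertible_def using DE ED by blast
  have left: "matrix_inv (diag e) ** diag e = mat 1"
    using someI_ex[OF inv[unfolded invertible_def]] unfolding matrix_inv_def by blast
  have "matrix_inv (diag e) = matrix_inv (diag e) ** (diag e ** ?E)"
    by (simp only: DE matrix_mul_rid)
  also have "\<dots> = ?E"
    by (simp only: matrix_mul_assoc left matrix_mul_lid)
  finally show "matrix_inv (diag e) = ?E" .
qed

theorem theorem2p7:
  fixes A B :: "'n::finite tensor" and m :: nat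
  assumes "m \<ge> 3"
    and "A \<in> tensors m" and "B \<in> tensors m"
    and "similar m A B"
  shows "\<exists>C \<in> tensors m. diagonal_similar m A C \<and> permutational_similar m B C"
proof -
  obtain P Q where PQ: "tensor_prod m P (unit_tensor m) Q = unit_tensor m"
    and B: "B = tensor_prod m P A Q"
    using assms(4) by (auto simp: similar_def)
  obtain \<tau> d where bij: "bij \<tau>" and d: "\<And>j. d j \<noteq> 0"
    and Q: "\<And>i j. Q $ j $ i = (if i = \<tau> j then d j else 0)"
    and P: "\<And>i j. P $ i $ j = (if i = \<tau> j then inverse (d j) ^ (m - 1) else 0)"
    using unit_preserving_pair_monomial[OF assms(1) PQ] by blast
  define D where "D = diag d"
  define C where "C = tensor_prod m (matrix_power (matrix_inv D) (m - 1)) A D"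
  define S :: "complex^'n^'n" where "S = (\<chi> i j. if j = \<tau> i then 1 else 0)"
  have "C \<in> tensors m" by (simp add: tensors_def C_def tensor_prod_def)
  moreover have "diagonal_similar m A C"
    unfolding diagonal_similar_def
  proof (intro exI conjI)
    show "diagonal_matrix D" by (simp add: diagonal_matrix_def D_def)
    show "invertible D" unfolding D_def using d by (rule diag_inverse)
  qed (rule C_def)
  moreover have "permutational_similar m B C"
    unfolding permutational_similar_def
  proof (intro exI conjI)
    show "permutation_matrix S"
      unfolding permutation_matrix_def S_def using bij by (auto simp: permutes_def bij_iff)
    show "C = tensor_prod m S B (transpose S)"
    proof
      fix "is" :: "'n list"
      show "C is = tensor_prod m S B (transpose S) is"
      proof (cases "length is = m")
        case False
        then show ?thesis by (simp add: C_def tensor_prod_def)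
      next
        case len: True
        have pos: "m > 0" using assms(1) by simp
        have inv: "(i = \<tau> j) = (j = inv \<tau> i)" for i j
          using bij by (metis bij_inv_eq_iff)
        have cancel: "inv \<tau> (\<tau> i) = i" for i
          using bij by (simp add: bij_is_inj)
        have "C is = inverse (d (is ! 0)) ^ (m - 1) * A (map (\<lambda>i. i) is) * (\<Prod>k=1..<m. d (is ! k))"
          unfolding C_def D_def diag_inverse(2)[of d, OF d] matrix_power_diag
          by (rule tensor_prod_monomial[OF len pos]) auto
        \<comment> \<open>\<open>P\<close> and \<open>Q\<close> are monomial along \<open>inv \<tau>\<close>, so evaluating \<open>B\<close> at \<open>map \<tau> is\<close> undoes the relabelling.\<close>
        also have "\<dots> = B (map \<tau> is)"
        proof -
          have "B (map \<tau> is) = inverse (d (inv \<tau> (map \<tau> is ! 0))) ^ (m - 1)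
              * A (map (inv \<tau>) (map \<tau> is)) * (\<Prod>k=1..<m. d (inv \<tau> (map \<tau> is ! k)))"
            unfolding B
            by (rule tensor_prod_monomial) (use len pos in \<open>auto simp: P Q inv\<close>)
          then show ?thesis using len pos by (simp add: cancel comp_def)
        qed
        also have "\<dots> = tensor_prod m S B (transpose S) is"
          by (subst tensor_prod_monomial[OF len pos, where f = \<tau> and p = "\<lambda>_. 1" and q = "\<lambda>_. 1"])
            (auto simp: S_def transpose_def)
        finally show ?thesis .
      qed
    qed
  qed
  ultimately show ?thesis by blast
qed

end
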